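(* For arbitrary star-finite pointed simplicial models $(\mathcal C,X)$ and $(\mathcal C',X')$, \[ (\mathcal C,X)\equiv_{\mathcal L^+}(\mathcal C',X') \quad\Longrightarrow\quad (\mathcal C,X)\mathrel{\underline{\leftrightarrow}}(\mathcal C',X'). \]
   Context: Let $A$ be a finite set of agents and, for each $a\in A$, $P_a$ a countable set of local atoms (mutually disjoint). The language $\mathcal L^+$ is $\varphi ::= a \mid p_a \mid \neg\varphi \mid (\varphi\wedge\varphi)\mid \widehat K_a\varphi$ with $a\in A$ (global atom "agent $a$ is alive") and $p_a\in P_a$. A simplicial model $\mathcal C=(C,\chi,\ell)$ consists of a nonempty downward-closed set $C$ of nonempty finite subsets (simplexes) of a vertex set containing all singletons, a chromatic map $\chi$ from vertices to agents injective on each simplex, and a valuation $\ell$ assigning to each vertex $v$ a subset of $P_{\chi(v)}$; $\chi(X)$ and $\ell(X)$ are the unions over vertices of $X$; $\mathcal F(C)$ is the set of facets; a pointed model is $(\mathcal C,X)$ with $X\in\mathcal F(C)$. A simplicial model is star-finite iff for each agent $a$, every facet has only finitely many facets $Y$ with $a\in\chi(X\cap Y)$. Three-valued semantics on facets: definability $\bowtie$: $a$ always defined; $p_a$ defined iff $a\in\chi(X)$; $\neg\varphi$ defined iff $\varphi$ is; $\varphi\wedge\psi$ defined iff both are; $\widehat K_a\varphi$ defined iff $\varphi$ is defined in some facet $Y$ with $a\in\chi(X\cap Y)$. Truth $\vDash$: $a$ true iff $a\in\chi(X)$; $p_a$ true iff $p_a\in\ell(X)$; $\neg\varphi$ true iff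 $\varphi$ defined and not true; $\varphi\wedge\psi$ true iff both true; $\widehat K_a\varphi$ true iff $\varphi$ true in some facet $Y$ with $a\in\chi(X\cap Y)$. $(\mathcal C,X)\equiv_{\mathcal L^+}(\mathcal C',X')$ means that for every $\varphi\in\mathcal L^+$, $\varphi$ is defined/true/has true negation in $(\mathcal C,X)$ iff the same holds in $(\mathcal C',X')$. A bisimulation between $\mathcal C$ and $\mathcal C'$ is a nonempty relation $\mathcal B\subseteq\mathcal F(C)\times\mathcal F(C')$ such that whenever $X\mathcal B X'$: (atoms) $\chi(X)=\chi'(X')$ and $\ell(X)=\ell'(X')$; (forth) for each $a$ and each facet $Y$ with $a\in\chi(X\cap Y)$ there is a facet $Y'$ with $a\in\chi'(X'\cap Y')$ and $Y\mathcal B Y'$; (back) symmetrically. $(\mathcal C,X)\mathrel{\underline{\leftrightarrow}}(\mathcal C',X')$ means there is a bisimulation relating $X$ and $X'$. *)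

theory Defs
  imports "HOL-Library.Countable_Set" "HOL-Library.Disjoint_Sets"
begin

text \<open>The agents form the set \<open>A\<close>, and \<open>P a\<close> is the set of local atoms of agent \<open>a\<close>.\<close>

definition signature :: "'a set \<Rightarrow> ('a \<Rightarrow> 'p set) \<Rightarrow> bool" where
  "signature A P \<longleftrightarrow>
     finite A \<and> (\<forall>a\<in>A. countable (P a)) \<and> disjoint_family_on P A"

text \<open>\<open>Alive a\<close> is the global atom \<open>a\<close>, and \<open>Loc a p\<close> is the local atom \<open>p\<^sub>a\<close>. The datatype does
  not enforce \<open>a \<in> A\<close> or \<open>p \<in> P a\<close>; the language proper is the set \<open>lang A P\<close>.\<close>

datatype ('a, 'p) form =
    Alive 'a
  | Loc 'a 'p
  | Neg "('a, 'p) form"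
  | Conj "('a, 'p) form" "('a, 'p) form"
  | DualK 'a "('a, 'p) form"

inductive_set lang :: "'a set \<Rightarrow> ('a \<Rightarrow> 'p set) \<Rightarrow> ('a, 'p) form set"
  for A :: "'a set" and P :: "'a \<Rightarrow> 'p set" where
  Alive: "a \<in> A \<Longrightarrow> Alive a \<in> lang A P"
| Loc: "a \<in> A \<Longrightarrow> p \<in> P a \<Longrightarrow> Loc a p \<in> lang A P"
| Neg: "\<phi> \<in> lang A P \<Longrightarrow> Neg \<phi> \<in> lang A P"
| Conj: "\<phi> \<in> lang A P \<Longrightarrow> \<psi> \<in> lang A P \<Longrightarrow> Conj \<phi> \<psi> \<in> lang A P"
| DualK: "a \<in> A \<Longrightarrow> \<phi> \<in> lang A P \<Longrightarrow> DualK a \<phi> \<in> lang A P"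

record ('v, 'a, 'p) smodel =
  verts :: "'v set"
  simps :: "'v set set"
  color :: "'v \<Rightarrow> 'a"
  valu :: "'v \<Rightarrow> 'p set"

definition simplicial_model ::
  "'a set \<Rightarrow> ('a \<Rightarrow> 'p set) \<Rightarrow> ('v, 'a, 'p) smodel \<Rightarrow> bool" where
  "simplicial_model A P M \<longleftrightarrow>
     simps M \<noteq> {} \<and>
     (\<forall>X\<in>simps M. X \<noteq> {} \<and> finite X \<and> X \<subseteq> verts M) \<and>
     (\<forall>X\<in>simps M. \<forall>Y. Y \<noteq> {} \<and> Y \<subseteq> X \<longrightarrow> Y \<in> simps M) \<and>
     (\<forall>v\<in>verts M. {v} \<in> simps M) \<and>
     color M ` verts M \<subseteq> A \<and>
     (\<forall>X\<in>simps M. inj_on (color M) X) \<and>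
     (\<forall>v\<in>verts M. valu M v \<subseteq> P (color M v))"

definition colors :: "('v, 'a, 'p) smodel \<Rightarrow> 'v set \<Rightarrow> 'a set" where
  "colors M X = color M ` X"

definition atoms :: "('v, 'a, 'p) smodel \<Rightarrow> 'v set \<Rightarrow> 'p set" where
  "atoms M X = (\<Union>v\<in>X. valu M v)"

definition facets :: "('v, 'a, 'p) smodel \<Rightarrow> 'v set set" where
  "facets M = {X \<in> simps M. \<forall>Y\<in>simps M. X \<subseteq> Y \<longrightarrow> Y = X}"

definition pointed_model ::
  "'a set \<Rightarrow> ('a \<Rightarrow> 'p set) \<Rightarrow> ('v, 'a, 'p) smodel \<Rightarrow> 'v set \<Rightarrow> bool" where
  "pointed_model A P M X \<longleftrightarrow> simplicial_model A P M \<and> X \<in> facets M"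

definition star_finite :: "'a set \<Rightarrow> ('v, 'a, 'p) smodel \<Rightarrow> bool" where
  "star_finite A M \<longleftrightarrow>
     (\<forall>a\<in>A. \<forall>X\<in>facets M. finite {Y \<in> facets M. a \<in> colors M (X \<inter> Y)})"

primrec defined :: "('v, 'a, 'p) smodel \<Rightarrow> 'v set \<Rightarrow> ('a, 'p) form \<Rightarrow> bool" where
  "defined M X (Alive a) \<longleftrightarrow> True"
| "defined M X (Loc a p) \<longleftrightarrow> a \<in> colors M X"
| "defined M X (Neg \<phi>) \<longleftrightarrow> defined M X \<phi>"
| "defined M X (Conj \<phi> \<psi>) \<longleftrightarrow> defined M X \<phi> \<and> defined M X \<psi>"
| "defined M X (DualK a \<phi>) \<longleftrightarrow>
     (\<exists>Y\<in>facets M. a \<in> colors M (X \<inter> Y) \<and> defined M Y \<phi>)"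

text \<open>In the clause for \<open>Loc a p\<close> the owner \<open>a\<close> need not be mentioned: the atom sets are
  disjoint, so for \<open>p \<in> P a\<close> only a vertex of colour \<open>a\<close> can contribute \<open>p\<close>.\<close>

primrec satisfies :: "('v, 'a, 'p) smodel \<Rightarrow> 'v set \<Rightarrow> ('a, 'p) form \<Rightarrow> bool" where
  "satisfies M X (Alive a) \<longleftrightarrow> a \<in> colors M X"
| "satisfies M X (Loc a p) \<longleftrightarrow> p \<in> atoms M X"
| "satisfies M X (Neg \<phi>) \<longleftrightarrow> defined M X \<phi> \<and> \<not> satisfies M X \<phi>"
| "satisfies M X (Conj \<phi> \<psi>) \<longleftrightarrow> satisfies M X \<phi> \<and> satisfies M X \<psi>"
| "satisfies M X (DualK a \<phi>) \<longleftrightarrow>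
     (\<exists>Y\<in>facets M. a \<in> colors M (X \<inter> Y) \<and> satisfies M Y \<phi>)"

definition lang_equiv ::
  "'a set \<Rightarrow> ('a \<Rightarrow> 'p set) \<Rightarrow> ('v, 'a, 'p) smodel \<Rightarrow> 'v set \<Rightarrow>
   ('w, 'a, 'p) smodel \<Rightarrow> 'w set \<Rightarrow> bool" where
  "lang_equiv A P M X M' X' \<longleftrightarrow>
     (\<forall>\<phi>\<in>lang A P.
        (defined M X \<phi> \<longleftrightarrow> defined M' X' \<phi>) \<and>
        (satisfies M X \<phi> \<longleftrightarrow> satisfies M' X' \<phi>) \<and>
        (satisfies M X (Neg \<phi>) \<longleftrightarrow> satisfies M' X' (Neg \<phi>)))"

definition bisimulation ::
  "'a set \<Rightarrow> ('v, 'a, 'p) smodel \<Rightarrow> ('w, 'a, 'p) smodel \<Rightarrow> ('v set \<times> 'w set) set \<Rightarrow> bool" where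
  "bisimulation A M M' B \<longleftrightarrow>
     B \<noteq> {} \<and> B \<subseteq> facets M \<times> facets M' \<and>
     (\<forall>(X, X')\<in>B.
        (colors M X = colors M' X' \<and> atoms M X = atoms M' X') \<and>
        (\<forall>a\<in>A. \<forall>Y\<in>facets M. a \<in> colors M (X \<inter> Y) \<longrightarrow>
           (\<exists>Y'\<in>facets M'. a \<in> colors M' (X' \<inter> Y') \<and> (Y, Y') \<in> B)) \<and>
        (\<forall>a\<in>A. \<forall>Y'\<in>facets M'. a \<in> colors M' (X' \<inter> Y') \<longrightarrow>
           (\<exists>Y\<in>facets M. a \<in> colors M (X \<inter> Y) \<and> (Y, Y') \<in> B)))"

definition bisimilar ::
  "'a set \<Rightarrow> ('v, 'a, 'p) smodel \<Rightarrow> 'v set \<Rightarrow> ('w, 'a, 'p) smodel \<Rightarrow> 'w set \<Rightarrow> bool" where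
  "bisimilar A M X M' X' \<longleftrightarrow> (\<exists>B. bisimulation A M M' B \<and> (X, X') \<in> B)"

end

theory Submission
  imports Defs
begin

text \<open>The classical Hennessy--Milner argument (conjoin, over the finite star, formulas true in one
  facet but not in the others) needs non-equivalent facets \<open>Y\<close>, \<open>Y'\<close> to be separated by a formula
  that is true in \<open>Y\<close> and not true in \<open>Y'\<close>. The critical case is a formula that is defined in
  \<open>Y'\<close> only, as undefinedness is not expressible. It is resolved by approximating simulation in
  stages: stage \<open>n + 1\<close> at a given facet \<open>Y'\<close> is forced by a formula, true in \<open>Y'\<close>, that is already
  defined wherever stage \<open>n\<close> holds. Hence if all truths of \<open>Y\<close> are truths of \<open>Y'\<close>, then \<open>Y\<close>
  simulates \<open>Y'\<close> at all stages, and simulation transports definability from \<open>Y'\<close> to \<open>Y\<close>.\<close>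

text \<open>The language has no truth constant, so the empty conjunction is a negated contradiction
  about \<open>Alive a\<close>, defined and true in every facet. The parameter only supplies an
  agent that keeps it inside \<open>lang A P\<close>.\<close>

definition conjs :: "'a \<Rightarrow> ('a, 'p) form list \<Rightarrow> ('a, 'p) form" where
  "conjs a \<phi>s = foldr Conj \<phi>s (Neg (Conj (Alive a) (Neg (Alive a))))"

lemma conjs_in_lang: "a \<in> A \<Longrightarrow> set \<phi>s \<subseteq> lang A P \<Longrightarrow> conjs a \<phi>s \<in> lang A P"
  unfolding conjs_def by (induction \<phi>s) (auto intro: lang.intros)

lemma defined_conjs: "defined M X (conjs a \<phi>s) \<longleftrightarrow> (\<forall>\<phi>\<in>set \<phi>s. defined M X \<phi>)"
  unfolding conjs_def by (induction \<phi>s) auto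

lemma satisfies_conjs: "satisfies M X (conjs a \<phi>s) \<longleftrightarrow> (\<forall>\<phi>\<in>set \<phi>s. satisfies M X \<phi>)"
  unfolding conjs_def by (induction \<phi>s) auto

lemma facet_vertexD:
  assumes "simplicial_model A P M" "X \<in> facets M" "v \<in> X"
  shows "color M v \<in> A" "valu M v \<subseteq> P (color M v)"
proof -
  have "v \<in> verts M"
    using assms by (auto simp: simplicial_model_def facets_def)
  then show "color M v \<in> A" "valu M v \<subseteq> P (color M v)"
    using assms(1) by (auto simp: simplicial_model_def image_subset_iff)
qed

lemma colors_subset: "simplicial_model A P M \<Longrightarrow> X \<in> facets M \<Longrightarrow> colors M X \<subseteq> A"
  unfolding colors_def by (auto dest: facet_vertexD)

lemma colors_nonempty: "simplicial_model A P M \<Longrightarrow> X \<in> facets M \<Longrightarrow> colors M X \<noteq> {}"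
  unfolding colors_def simplicial_model_def facets_def by auto

lemma colors_IntD: "a \<in> colors M (X \<inter> Y) \<Longrightarrow> a \<in> colors M X \<and> a \<in> colors M Y"
  unfolding colors_def by auto

text \<open>Only local atoms need care: by disjointness of the atom sets, a vertex contributing
  \<open>p\<close> must have the colour of the owner of \<open>p\<close>.\<close>

lemma satisfies_imp_defined:
  assumes "signature A P" "simplicial_model A P M" "\<phi> \<in> lang A P" "X \<in> facets M"
    and "satisfies M X \<phi>"
  shows "defined M X \<phi>"
  using assms(3-)
proof (induction arbitrary: X)
  case (Loc a p)
  then obtain v where v: "v \<in> X" "p \<in> valu M v"
    by (auto simp: atoms_def)
  then have "color M v \<in> A" "p \<in> P (color M v)"
    using facet_vertexD[OF assms(2) \<open>X \<in> facets M\<close>] by auto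
  then have "color M v = a"
    using assms(1) Loc.hyps unfolding signature_def disjoint_family_on_def by blast
  then show ?case
    using v by (auto simp: colors_def)
qed auto

text \<open>Definability depends on colours and neighbours alone, so valuations are ignored. One
  direction suffices: neighbours of \<open>Y'\<close> are matched by neighbours of \<open>Y\<close>,
  so \<open>defined\<close> passes from \<open>Y'\<close> to \<open>Y\<close>.\<close>

primrec simulates ::
  "nat \<Rightarrow> ('v, 'a, 'p) smodel \<Rightarrow> 'v set \<Rightarrow> ('w, 'a, 'p) smodel \<Rightarrow> 'w set \<Rightarrow> bool" where
  "simulates 0 M Y M' Y' \<longleftrightarrow> True"
| "simulates (Suc n) M Y M' Y' \<longleftrightarrow> colors M Y = colors M' Y' \<and>
     (\<forall>a. \<forall>Z'\<in>facets M'. a \<in> colors M' (Y' \<inter> Z') \<longrightarrow>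
        (\<exists>Z\<in>facets M. a \<in> colors M (Y \<inter> Z) \<and> simulates n M Z M' Z'))"

text \<open>All clauses of \<open>defined\<close> are positive, and each \<open>DualK\<close> uses
  up one stage. The strict bound leaves a stage at local atoms, where colours are compared.\<close>

lemma simulates_defined:
  assumes "simulates n M Y M' Y'" "size \<phi> < n" "defined M' Y' \<phi>"
  shows "defined M Y \<phi>"
  using assms
proof (induction \<phi> arbitrary: n Y Y')
  case (Loc a p)
  then show ?case by (cases n) auto
next
  case (DualK a \<phi>)
  then obtain m where "n = Suc m" by (cases n) auto
  with DualK show ?case by simp blast
qed auto

text \<open>A full description of the living and dead agents, possible since \<open>A\<close> is
  finite; built from \<open>Alive\<close> atoms only, it is defined everywhere.\<close>

lemma colors_formula:
  fixes M :: "('v, 'a, 'p) smodel" and M' :: "('w, 'a, 'p) smodel"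
  assumes "finite A" "simplicial_model A P M" "simplicial_model A P M'" "Y' \<in> facets M'"
  obtains \<kappa> where "\<kappa> \<in> lang A P" "satisfies M' Y' \<kappa>" "\<And>Y. defined M Y \<kappa>"
    "\<And>Y. Y \<in> facets M \<Longrightarrow> satisfies M Y \<kappa> \<Longrightarrow> colors M Y = colors M' Y'"
proof -
  obtain e where e: "e \<in> A"
    using colors_nonempty[OF assms(3,4)] colors_subset[OF assms(3,4)] by blast
  obtain bs where bs: "set bs = A" using assms(1) finite_list by blast
  define L where "L = (\<lambda>b. if b \<in> colors M' Y' then Alive b else Neg (Alive b) :: ('a, 'p) form)"
  define \<kappa> where "\<kappa> = conjs e (map L bs)"
  show ?thesis
  proof
    show "\<kappa> \<in> lang A P"
      unfolding \<kappa>_def using e bs by (intro conjs_in_lang) (auto simp: L_def intro: lang.intros)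
    show "satisfies M' Y' \<kappa>" "defined M Y \<kappa>" for Y
      unfolding \<kappa>_def satisfies_conjs defined_conjs by (auto simp: L_def)
    fix Y assume Y: "Y \<in> facets M" and "satisfies M Y \<kappa>"
    then have "\<forall>b\<in>A. satisfies M Y (L b)"
      by (simp add: \<kappa>_def satisfies_conjs bs)
    then have "\<forall>b\<in>A. b \<in> colors M Y \<longleftrightarrow> b \<in> colors M' Y'"
      by (auto simp: L_def split: if_splits)
    then show "colors M Y = colors M' Y'"
      using colors_subset[OF assms(2) Y] colors_subset[OF assms(3,4)] by blast
  qed
qed

text \<open>The formula describes the colours of \<open>Y'\<close> and says that each neighbour's
  formula of the previous stage is possible. Star-finiteness of \<open>M'\<close> keeps this
  conjunction finite.\<close>

lemma simulates_formula:
  fixes M :: "('v, 'a, 'p) smodel" and M' :: "('w, 'a, 'p) smodel"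
  assumes "finite A" "simplicial_model A P M" "simplicial_model A P M'" "star_finite A M'"
    and "Y' \<in> facets M'"
  shows "\<exists>\<tau>\<in>lang A P. satisfies M' Y' \<tau> \<and>
    (\<forall>Y\<in>facets M. (simulates n M Y M' Y' \<longrightarrow> defined M Y \<tau>) \<and>
      (satisfies M Y \<tau> \<longrightarrow> simulates (Suc n) M Y M' Y'))"
  using assms(5)
proof (induction n arbitrary: Y')
  case 0
  obtain \<kappa> where \<kappa>: "\<kappa> \<in> lang A P" "satisfies M' Y' \<kappa>" "\<And>Y. defined M Y \<kappa>"
    "\<And>Y. Y \<in> facets M \<Longrightarrow> satisfies M Y \<kappa> \<Longrightarrow> colors M Y = colors M' Y'"
    using colors_formula[OF assms(1-3) 0] by blast
  have "simulates (Suc 0) M Y M' Y'" if Y: "Y \<in> facets M" and sat: "satisfies M Y \<kappa>" for Y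
  proof -
    \<comment> \<open>Stage 0 holds trivially, so \<open>Y\<close> serves as its own
      neighbour.\<close>
    have "\<exists>Z\<in>facets M. a \<in> colors M (Y \<inter> Z)" if "a \<in> colors M' (Y' \<inter> Z')" for a Z'
      using colors_IntD[OF that] \<kappa>(4)[OF Y sat] Y by (intro bexI[of _ Y]) auto
    then show ?thesis
      using \<kappa>(4)[OF Y sat] by simp
  qed
  with \<kappa> show ?case by blast
next
  case (Suc n)
  obtain \<kappa> where \<kappa>: "\<kappa> \<in> lang A P" "satisfies M' Y' \<kappa>" "\<And>Y. defined M Y \<kappa>"
    "\<And>Y. Y \<in> facets M \<Longrightarrow> satisfies M Y \<kappa> \<Longrightarrow> colors M Y = colors M' Y'"
    using colors_formula[OF assms(1-3) Suc.prems] by blast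
  obtain e where e: "e \<in> A"
    using colors_nonempty[OF assms(3) Suc.prems] colors_subset[OF assms(3) Suc.prems] by blast
  \<comment> \<open>Pairs, because one facet may be adjacent to \<open>Y'\<close> through several
    agents.\<close>
  define S where "S = (SIGMA a:A. {Z' \<in> facets M'. a \<in> colors M' (Y' \<inter> Z')})"
  have "finite S"
    using assms(1,4) Suc.prems unfolding S_def star_finite_def by auto
  then obtain zs where zs: "set zs = S" using finite_list by blast
  have in_S: "(a, Z') \<in> S" if "Z' \<in> facets M'" "a \<in> colors M' (Y' \<inter> Z')" for a Z'
    using that colors_IntD[OF that(2)] colors_subset[OF assms(3) that(1)] by (auto simp: S_def)
  obtain t where t: "\<And>Z'. Z' \<in> facets M' \<Longrightarrow> t Z' \<in> lang A P \<and> satisfies M' Z' (t Z') \<and>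
    (\<forall>Y\<in>facets M. (simulates n M Y M' Z' \<longrightarrow> defined M Y (t Z')) \<and>
      (satisfies M Y (t Z') \<longrightarrow> simulates (Suc n) M Y M' Z'))"
    using Suc.IH by metis
  define \<tau> where "\<tau> = conjs e (\<kappa> # map (\<lambda>(a, Z'). DualK a (t Z')) zs)"
  have "\<tau> \<in> lang A P"
    unfolding \<tau>_def using e \<kappa>(1) zs t
    by (intro conjs_in_lang) (auto simp: S_def intro!: lang.intros)
  moreover have "satisfies M' Y' \<tau>"
    unfolding \<tau>_def satisfies_conjs using \<kappa>(2) zs t by (auto simp: S_def)
  moreover have "defined M Y \<tau>" if sim: "simulates (Suc n) M Y M' Y'" for Y
  proof -
    \<comment> \<open>Stage \<open>Suc n\<close> at \<open>Y\<close> provides a neighbour simulating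
      \<open>Z'\<close> at stage \<open>n\<close>, and there \<open>t Z'\<close> is defined.\<close>
    have "\<exists>Z\<in>facets M. a \<in> colors M (Y \<inter> Z) \<and> defined M Z (t Z')" if "(a, Z') \<in> S" for a Z'
      using that sim t by (fastforce simp: S_def)
    then show ?thesis
      unfolding \<tau>_def defined_conjs using \<kappa>(3) zs by auto
  qed
  moreover have "simulates (Suc (Suc n)) M Y M' Y'"
    if Y: "Y \<in> facets M" and sat: "satisfies M Y \<tau>" for Y
  proof -
    have "satisfies M Y \<kappa>" and nbr: "\<And>a Z'. (a, Z') \<in> S \<Longrightarrow> satisfies M Y (DualK a (t Z'))"
      using sat zs unfolding \<tau>_def satisfies_conjs by auto
    then have "colors M Y = colors M' Y'"
      using \<kappa>(4) Y by blast
    moreover have "\<exists>Z\<in>facets M. a \<in> colors M (Y \<inter> Z) \<and> simulates (Suc n) M Z M' Z'"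
      if "Z' \<in> facets M'" "a \<in> colors M' (Y' \<inter> Z')" for a Z'
      using nbr[OF in_S[OF that]] t[OF that(1)] unfolding satisfies.simps(5) by blast
    ultimately show ?thesis
      unfolding simulates.simps(2)[of "Suc n"] by blast
  qed
  ultimately show ?case by blast
qed

text \<open>Read contrapositively, this yields for inequivalent facets a formula true in
  \<open>Y\<close> and not in \<open>Y'\<close>, never just one separating the other way
  round.\<close>

lemma lang_equivI:
  fixes M :: "('v, 'a, 'p) smodel" and M' :: "('w, 'a, 'p) smodel"
  assumes "signature A P" "simplicial_model A P M" "simplicial_model A P M'" "star_finite A M'"
    and "Y \<in> facets M" "Y' \<in> facets M'"
    and incl: "\<And>\<phi>. \<phi> \<in> lang A P \<Longrightarrow> satisfies M Y \<phi> \<Longrightarrow> satisfies M' Y' \<phi>"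
  shows "lang_equiv A P M Y M' Y'"
proof -
  have fin: "finite A" using assms(1) by (simp add: signature_def)
  have sim: "simulates n M Y M' Y'" for n
  proof (induction n)
    case (Suc n)
    obtain \<tau> where \<tau>: "\<tau> \<in> lang A P" "satisfies M' Y' \<tau>"
      "simulates n M Y M' Y' \<longrightarrow> defined M Y \<tau>"
      "satisfies M Y \<tau> \<longrightarrow> simulates (Suc n) M Y M' Y'"
      using simulates_formula[OF fin assms(2-4,6)] assms(5) by blast
    \<comment> \<open>Since stage \<open>n\<close> makes \<open>\<tau>\<close> defined in
      \<open>Y\<close>, excluding its negation makes it true there, which forces stage
      \<open>Suc n\<close>.\<close>
    have "\<not> satisfies M Y (Neg \<tau>)"
      using incl[of "Neg \<tau>"] \<tau>(1,2) by (auto intro: lang.intros)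
    with Suc \<tau> show ?case by simp
  qed simp
  have def: "defined M Y \<phi> \<longleftrightarrow> defined M' Y' \<phi>" if "\<phi> \<in> lang A P" for \<phi>
  proof
    assume "defined M Y \<phi>"
    then have "satisfies M Y \<phi> \<or> satisfies M Y (Neg \<phi>)" by simp
    then have "satisfies M' Y' \<phi> \<or> satisfies M' Y' (Neg \<phi>)"
      using incl that lang.Neg by blast
    then show "defined M' Y' \<phi>"
      using satisfies_imp_defined[OF assms(1,3) that assms(6)] by auto
  next
    assume "defined M' Y' \<phi>"
    then show "defined M Y \<phi>"
      using simulates_defined[OF sim[of "Suc (size \<phi>)"]] by simp
  qed
  \<comment> \<open>If \<open>\<phi>\<close> were true in \<open>Y'\<close> only, it would still be
    defined in \<open>Y\<close>, so its negation would be true in \<open>Y\<close> and hence in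
    \<open>Y'\<close>.\<close>
  have sat: "satisfies M Y \<phi> \<longleftrightarrow> satisfies M' Y' \<phi>" if "\<phi> \<in> lang A P" for \<phi>
    using incl[OF that] incl[OF lang.Neg[OF that]] def[OF that]
      satisfies_imp_defined[OF assms(1,3) that assms(6)] by auto
  show ?thesis
    unfolding lang_equiv_def using def sat lang.Neg by blast
qed

lemma lang_equiv_sym: "lang_equiv A P M X M' X' \<Longrightarrow> lang_equiv A P M' X' M X"
  unfolding lang_equiv_def by blast

lemma lang_equiv_colors:
  assumes "simplicial_model A P M" "simplicial_model A P M'" "X \<in> facets M" "X' \<in> facets M'"
    and "lang_equiv A P M X M' X'"
  shows "colors M X = colors M' X'"
proof -
  have "\<forall>a\<in>A. a \<in> colors M X \<longleftrightarrow> a \<in> colors M' X'"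
    using assms(5) lang.Alive unfolding lang_equiv_def by (metis satisfies.simps(1))
  then show ?thesis
    using colors_subset[OF assms(1,3)] colors_subset[OF assms(2,4)] by blast
qed

lemma lang_equiv_atoms_subset:
  assumes "simplicial_model A P M" "X \<in> facets M" "lang_equiv A P M X M' X'"
  shows "atoms M X \<subseteq> atoms M' X'"
proof
  fix p assume p: "p \<in> atoms M X"
  then obtain v where "v \<in> X" "p \<in> valu M v"
    by (auto simp: atoms_def)
  \<comment> \<open>The vertex carrying \<open>p\<close> supplies the owner.\<close>
  then have "Loc (color M v) p \<in> lang A P"
    using facet_vertexD[OF assms(1,2)] by (auto intro: lang.intros)
  with p assms(3) show "p \<in> atoms M' X'"
    unfolding lang_equiv_def by (metis satisfies.simps(2))
qed

text \<open>Otherwise every facet in the finite \<open>a\<close>-star of \<open>X'\<close> fails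
  some formula true in \<open>Y\<close>. The conjunction of these is possible for \<open>a\<close>
  at \<open>X\<close>, hence at \<open>X'\<close>, but a witness there would satisfy its own
  separating formula.\<close>

lemma lang_equiv_forth:
  fixes M :: "('v, 'a, 'p) smodel" and M' :: "('w, 'a, 'p) smodel"
  assumes "signature A P" "simplicial_model A P M" "simplicial_model A P M'" "star_finite A M'"
    and "X \<in> facets M" "X' \<in> facets M'" "lang_equiv A P M X M' X'"
    and "a \<in> A" "Y \<in> facets M" "a \<in> colors M (X \<inter> Y)"
  shows "\<exists>Y'\<in>facets M'. a \<in> colors M' (X' \<inter> Y') \<and> lang_equiv A P M Y M' Y'"
proof (rule ccontr)
  define S where "S = {Y' \<in> facets M'. a \<in> colors M' (X' \<inter> Y')}"
  assume "\<not> ?thesis"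
  then have "\<forall>Y'\<in>S. \<exists>\<phi>\<in>lang A P. satisfies M Y \<phi> \<and> \<not> satisfies M' Y' \<phi>"
    using lang_equivI[OF assms(1-4,9)] by (auto simp: S_def)
  then obtain f where f: "\<And>Y'. Y' \<in> S \<Longrightarrow>
      f Y' \<in> lang A P \<and> satisfies M Y (f Y') \<and> \<not> satisfies M' Y' (f Y')"
    by metis
  have "finite S"
    using assms(4,6,8) unfolding S_def star_finite_def by blast
  then obtain ys where ys: "set ys = S" using finite_list by blast
  define \<phi> where "\<phi> = DualK a (conjs a (map f ys))"
  have "conjs a (map f ys) \<in> lang A P"
    using assms(8) f ys by (intro conjs_in_lang) auto
  then have "\<phi> \<in> lang A P"
    unfolding \<phi>_def using assms(8) by (intro lang.DualK)
  moreover have "satisfies M X \<phi>"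
    unfolding \<phi>_def using assms(9,10) f ys by (auto simp: satisfies_conjs)
  ultimately have "satisfies M' X' \<phi>"
    using assms(7) by (simp add: lang_equiv_def)
  then show False
    unfolding \<phi>_def using f ys by (auto simp: satisfies_conjs S_def)
qed

theorem theorem4p13:
  fixes A :: "'a set" and P :: "'a \<Rightarrow> 'p set"
    and M :: "('v, 'a, 'p) smodel" and X :: "'v set"
    and M' :: "('w, 'a, 'p) smodel" and X' :: "'w set"
  assumes "signature A P"
    and "pointed_model A P M X" and "star_finite A M"
    and "pointed_model A P M' X'" and "star_finite A M'"
    and "lang_equiv A P M X M' X'"
  shows "bisimilar A M X M' X'"
proof -
  \<comment> \<open>Equivalence itself, restricted to facets, is the bisimulation.\<close>
  define B where "B = {(Y, Y'). Y \<in> facets M \<and> Y' \<in> facets M' \<and> lang_equiv A P M Y M' Y'}"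
  have sm: "simplicial_model A P M" "simplicial_model A P M'" and XB: "(X, X') \<in> B"
    using assms by (auto simp: pointed_model_def B_def)
  have "colors M Y = colors M' Y' \<and> atoms M Y = atoms M' Y'" if "(Y, Y') \<in> B" for Y Y'
  proof -
    have Y: "Y \<in> facets M" "Y' \<in> facets M'" "lang_equiv A P M Y M' Y'"
      using that by (auto simp: B_def)
    then show ?thesis
      using lang_equiv_colors[OF sm Y] lang_equiv_atoms_subset[OF sm(1) Y(1,3)]
        lang_equiv_atoms_subset[OF sm(2) Y(2) lang_equiv_sym[OF Y(3)]] by blast
  qed
  moreover have "\<exists>Z'\<in>facets M'. a \<in> colors M' (Y' \<inter> Z') \<and> (Z, Z') \<in> B"
    if "(Y, Y') \<in> B" "a \<in> A" "Z \<in> facets M" "a \<in> colors M (Y \<inter> Z)" for Y Y' a Z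
    using lang_equiv_forth[OF assms(1) sm assms(5) _ _ _ that(2-4)] that(1,3)
    by (auto simp: B_def)
  \<comment> \<open>Back is forth with the models exchanged, now using star-finiteness of
    \<open>M\<close>.\<close>
  moreover have "\<exists>Z\<in>facets M. a \<in> colors M (Y \<inter> Z) \<and> (Z, Z') \<in> B"
    if YB: "(Y, Y') \<in> B" and Z: "a \<in> A" "Z' \<in> facets M'" "a \<in> colors M' (Y' \<inter> Z')" for Y Y' a Z'
  proof -
    have "lang_equiv A P M' Y' M Y"
      using YB by (auto simp: B_def intro: lang_equiv_sym)
    then obtain Z where "Z \<in> facets M" "a \<in> colors M (Y \<inter> Z)" "lang_equiv A P M' Z' M Z"
      using lang_equiv_forth[OF assms(1) sm(2,1) assms(3) _ _ _ Z] YB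
      by (auto simp: B_def)
    then show ?thesis
      using Z(2) lang_equiv_sym[of A P M' Z' M Z] by (auto simp: B_def)
  qed
  ultimately have "bisimulation A M M' B"
    unfolding bisimulation_def using XB by (auto simp: B_def)
  with XB show ?thesis
    unfolding bisimilar_def by blast
qed

end
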